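(* Let $H\subset\mathbb{R}$ be bounded. Let $I=H$ (with the usual metric) and let $s:[I]^{<\infty}\to\mathbb{R}$, $s(K)=\mathcal{A}(K)$. If $\mathrm{ext}(s,I)=A$, then $\mathcal{M}^{eds}(H)=A$.
   Context: $\mathcal{A}(K)$ denotes the arithmetic mean of the elements of a finite set $K\subset\mathbb{R}$. Definition of $\mathcal{M}^{eds}$: let $H\subset\mathbb{R}$ be bounded, $a=\inf H$, $b=\sup H$. For $n\in\mathbb{N}$ and $0\le i\le n$ let $H_{n,i}=H\cap[a+\frac in(b-a),a+\frac{i+1}n(b-a))$ and $I_n=\{0\le i\le n: H_{n,i}\ne\emptyset\}$. Then $\mathcal{M}^{eds}(H)=k$ means: for every $\epsilon>0$ there is $N\in\mathbb{N}$ such that $n>N$ and $\xi_i\in H_{n,i}$ ($i\in I_n$) imply $|\mathcal{A}(\{\xi_i:i\in I_n\})-k|<\epsilon$. For a set $I$, $[I]^{<\infty}$ is the set of all finite subsets of $I$. For a pseudo-metric space $(I,d)$, $B\subset I$ and $\epsilon>0$, let $S(B,\epsilon)=\bigcup_{x\in B}\{y\in I: d(x,y)<\epsilon\}$. The Hausdorff pseudo-metric on subsets of $I$ is $d_H(B,C)=\inf\{\epsilon>0: B\subset S(C,\epsilon),\ C\subset S(B,\epsilon)\}$ (with $\inf\emptyset=+\infty$). $I$ is totally bounded if for every $\delta>0$ there is a finite $K\subset I$ with $S(K,\delta)=I$. Let $(I,d)$ be a totally bounded pseudo-metric space, $s:[I]^{<\infty}\to\mathbb{R}$ and $A\in\mathbb{R}$.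 We write $\mathrm{ext}(s,I)=A$ if for every $\epsilon>0$ there is $\delta>0$ such that $K\in[I]^{<\infty}$ and $d_H(K,I)<\delta$ imply $|s(K)-A|<\epsilon$.
   Formalization: H is additionally assumed not to be a one-point set: for H={c} one has a=b, all H_{n,i} are empty, and the definition of M^eds(H) refers to the mean of the empty set, so the claim is undefined there although ext(s,I)=c. *)

theory Defs
  imports "HOL-Analysis.Analysis"
begin

text \<open>The arithmetic mean, intended for nonempty finite sets (HOL assigns 0 to the empty set).\<close>

definition arith_mean :: "real set \<Rightarrow> real" where
  "arith_mean K = (\<Sum>x\<in>K. x) / real (card K)"

definition eds_piece :: "real set \<Rightarrow> nat \<Rightarrow> nat \<Rightarrow> real set" where
  "eds_piece H n i =
     (let a = Inf H; b = Sup H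
      in H \<inter> {a + real i / real n * (b - a) ..< a + (real i + 1) / real n * (b - a)})"

definition eds_indices :: "real set \<Rightarrow> nat \<Rightarrow> nat set" where
  "eds_indices H n = {i. i \<le> n \<and> eds_piece H n i \<noteq> {}}"

text \<open>
  The partially defined quantity \<open>M^eds(H)\<close> is rendered by the relation \<open>M^eds(H) = k\<close>.
  If \<open>H\<close> is a singleton, all pieces are empty and the means involved are means of the empty set;
  the notion is meaningful only for \<open>H\<close> with at least two points.
\<close>

definition has_Meds :: "real set \<Rightarrow> real \<Rightarrow> bool" where
  "has_Meds H k \<longleftrightarrow>
     (\<forall>\<epsilon>>0. \<exists>N. \<forall>n>N. \<forall>\<xi> :: nat \<Rightarrow> real.
        (\<forall>i\<in>eds_indices H n. \<xi> i \<in> eds_piece H n i) \<longrightarrow>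
        \<bar>arith_mean (\<xi> ` eds_indices H n) - k\<bar> < \<epsilon>)"

locale pseudo_metric_space =
  fixes I :: "'a set" and d :: "'a \<Rightarrow> 'a \<Rightarrow> real"
  assumes nonneg: "x \<in> I \<Longrightarrow> y \<in> I \<Longrightarrow> 0 \<le> d x y"
    and self_zero: "x \<in> I \<Longrightarrow> d x x = 0"
    and symmetric: "x \<in> I \<Longrightarrow> y \<in> I \<Longrightarrow> d x y = d y x"
    and triangle_ineq: "x \<in> I \<Longrightarrow> y \<in> I \<Longrightarrow> z \<in> I \<Longrightarrow> d x z \<le> d x y + d y z"
begin

definition nbhd :: "'a set \<Rightarrow> real \<Rightarrow> 'a set" where
  "nbhd B \<epsilon> = (\<Union>x\<in>B. {y \<in> I. d x y < \<epsilon>})"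

text \<open>Extended-real valued, so that the infimum of the empty set is \<open>\<infinity>\<close>.\<close>

definition hausdorff_dist :: "'a set \<Rightarrow> 'a set \<Rightarrow> ereal" where
  "hausdorff_dist B C = Inf {ereal \<epsilon> |\<epsilon>. \<epsilon> > 0 \<and> B \<subseteq> nbhd C \<epsilon> \<and> C \<subseteq> nbhd B \<epsilon>}"

end

locale totally_bounded_pseudo_metric_space = pseudo_metric_space +
  assumes totally_bounded: "\<delta> > 0 \<Longrightarrow> \<exists>K. finite K \<and> K \<subseteq> I \<and> nbhd K \<delta> = I"
begin

text \<open>
  \<open>has_ext s A\<close> is the relation \<open>ext(s, I) = A\<close>. The function \<open>s\<close> is total on sets, but only its
  values on the finite subsets of \<open>I\<close> are used.
\<close>

definition has_ext :: "('a set \<Rightarrow> real) \<Rightarrow> real \<Rightarrow> bool" where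
  "has_ext s A \<longleftrightarrow>
     (\<forall>\<epsilon>>0. \<exists>\<delta>>0. \<forall>K\<in>Fpow I. hausdorff_dist K I < ereal \<delta> \<longrightarrow> \<bar>s K - A\<bar> < \<epsilon>)"

end

lemma bounded_real_totally_bounded:
  fixes H :: "real set"
  assumes "bounded H"
  shows "totally_bounded_pseudo_metric_space H dist"
proof -
  interpret pseudo_metric_space H dist
    by unfold_locales (auto simp: dist_commute dist_triangle)
  show ?thesis
  proof
    fix \<delta> :: real
    assume "\<delta> > 0"
    have "compact (closure H)"
      using assms by (simp add: compact_closure)
    moreover have "closure H \<subseteq> (\<Union>x\<in>H. ball x \<delta>)"
    proof
      fix y assume "y \<in> closure H"
      then obtain x where "x \<in> H" "dist x y < \<delta>"
        using \<open>\<delta> > 0\<close> by (meson closure_approachable)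
      then show "y \<in> (\<Union>x\<in>H. ball x \<delta>)" by auto
    qed
    ultimately obtain K where K: "K \<subseteq> H" "finite K" "closure H \<subseteq> (\<Union>x\<in>K. ball x \<delta>)"
      by (elim compactE_image) auto
    then have "nbhd K \<delta> = H"
      using closure_subset[of H] by (fastforce simp: nbhd_def)
    with K show "\<exists>K. finite K \<and> K \<subseteq> H \<and> nbhd K \<delta> = H" by blast
  qed
qed

end

theory Submission
  imports Defs
begin

text \<open>Picking one point from each nonempty piece of the n-th partition gives a finite set K
  \<subseteq> H. The pieces cover H (\<open>eds_piece_cover\<close>) and two points of one piece are
  closer than the mesh (Sup H - Inf H)/n (\<open>dist_eds_piece\<close>), so every point of H is
  within the mesh of K. Hence K is Hausdorff-close to H once n is large, whatever points were picked
  (\<open>hausdorff_dist_space_le\<close>), and the hypothesis on ext controls the mean of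
  K.\<close>

lemma eds_piece_subset: "eds_piece H n i \<subseteq> H"
  by (auto simp: eds_piece_def Let_def)

lemma dist_eds_piece:
  assumes "x \<in> eds_piece H n i" "y \<in> eds_piece H n i"
  shows "dist x y < (Sup H - Inf H) / real n"
proof -
  define a where "a = Inf H + real i / real n * (Sup H - Inf H)"
  have "Inf H + (real i + 1) / real n * (Sup H - Inf H) = a + (Sup H - Inf H) / real n"
    by (simp add: a_def add_divide_distrib diff_divide_distrib algebra_simps)
  with assms have "a \<le> x" "x < a + (Sup H - Inf H) / real n"
    "a \<le> y" "y < a + (Sup H - Inf H) / real n"
    by (auto simp: eds_piece_def Let_def a_def)
  then show ?thesis by (auto simp: dist_real_def)
qed

lemma Inf_less_Sup_if_not_singleton:
  fixes H :: "real set"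
  assumes "bounded H" "\<nexists>c. H = {c}" "x \<in> H"
  shows "Inf H < Sup H"
proof -
  obtain y where "y \<in> H" "y \<noteq> x" using assms(2,3) by blast
  with assms(1,3) have "Inf H \<le> x" "x \<le> Sup H" "Inf H \<le> y" "y \<le> Sup H"
    by (auto intro: cInf_lower cSup_upper bounded_imp_bdd_above bounded_imp_bdd_below)
  with \<open>y \<noteq> x\<close> show ?thesis by linarith
qed

text \<open>The index is the integer part of the position of x measured in steps of the mesh. A
  singleton must be excluded: with Inf H = Sup H every half-open piece is empty.\<close>

lemma eds_piece_cover:
  assumes "bounded H" "\<nexists>c. H = {c}" "x \<in> H" "n > 0"
  obtains i where "i \<in> eds_indices H n" "x \<in> eds_piece H n i"
proof -
  define L where "L = Sup H - Inf H"
  have L: "L > 0" using Inf_less_Sup_if_not_singleton[OF assms(1-3)] by (simp add: L_def)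
  have x: "Inf H \<le> x" "x - Inf H \<le> L"
    using assms by (auto simp: L_def intro: cInf_lower cSup_upper bounded_imp_bdd_above
        bounded_imp_bdd_below)
  define t where "t = real n * (x - Inf H) / L"
  have x_eq: "x = Inf H + t / real n * L"
    using L assms(4) by (simp add: t_def)
  have t: "0 \<le> t" "t \<le> real n"
    using x L by (simp_all add: t_def divide_le_eq mult_left_mono)
  define i where "i = nat \<lfloor>t\<rfloor>"
  have i: "real i \<le> t" "t < real i + 1"
    using t by (simp_all add: i_def)
  have "real i / real n * L \<le> t / real n * L" "t / real n * L < (real i + 1) / real n * L"
    using L i assms(4) by (simp_all add: divide_right_mono divide_strict_right_mono)
  then have "x \<in> eds_piece H n i"
    using assms(3) x_eq by (simp add: eds_piece_def Let_def flip: L_def)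
  \<comment> \<open>The value i = n occurs exactly when x = Sup H, which is why the indices run up
    to n inclusive.\<close>
  moreover have "i \<le> n" using i t by linarith
  ultimately show thesis using that by (auto simp: eds_indices_def)
qed

text \<open>For a subset of the space, one of the two inclusions in the Hausdorff distance is
  automatic, since each point has distance 0 to itself; only the covering of the space by K needs to
  be supplied.\<close>

lemma (in pseudo_metric_space) hausdorff_dist_space_le:
  assumes "K \<subseteq> I" "r > 0" "I \<subseteq> nbhd K r"
  shows "hausdorff_dist K I \<le> ereal r"
proof -
  have "K \<subseteq> nbhd I r"
  proof
    fix x assume "x \<in> K"
    with assms(1) have "x \<in> I" by blast
    with assms(2) self_zero[of x] show "x \<in> nbhd I r" by (auto simp: nbhd_def intro!: bexI[of _ x])
  qed
  then show ?thesis
    using assms unfolding hausdorff_dist_def by (intro Inf_lower) blast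
qed

theorem theorem4p23:
  fixes H :: "real set" and A :: real
  assumes "bounded H"
    and "\<nexists>c. H = {c}"
    and "totally_bounded_pseudo_metric_space.has_ext H dist arith_mean A"
  shows "has_Meds H A"
proof -
  interpret totally_bounded_pseudo_metric_space H dist
    by (rule bounded_real_totally_bounded[OF assms(1)])
  show ?thesis
    unfolding has_Meds_def
  proof (intro allI impI)
    fix \<epsilon> :: real
    assume "\<epsilon> > 0"
    then obtain \<delta> where \<delta>: "\<delta> > 0"
      and ext: "\<And>K. K \<in> Fpow H \<Longrightarrow> hausdorff_dist K H < ereal \<delta> \<Longrightarrow> \<bar>arith_mean K - A\<bar> < \<epsilon>"
      using assms(3) unfolding has_ext_def by blast
    \<comment> \<open>The Hausdorff distance is an infimum, so covering at radius \<open>r\<close>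
      only bounds it by \<le> \<open>r\<close>; a radius below \<open>\<delta>\<close> restores the
      strict inequality.\<close>
    define r where "r = \<delta> / 2"
    have r: "0 < r" "r < \<delta>" using \<delta> by (auto simp: r_def)
    \<comment> \<open>This makes the mesh smaller than \<open>r\<close> for all n >
      \<open>N\<close>; such n are positive, so the division by n is genuine.\<close>
    obtain N :: nat where N: "Sup H - Inf H < real N * r"
      using reals_Archimedean3[OF r(1)] by blast
    show "\<exists>N. \<forall>n>N. \<forall>\<xi>. (\<forall>i\<in>eds_indices H n. \<xi> i \<in> eds_piece H n i) \<longrightarrow>
        \<bar>arith_mean (\<xi> ` eds_indices H n) - A\<bar> < \<epsilon>"
    proof (intro exI[of _ N] allI impI)
      fix n \<xi>
      assume n: "N < n" and \<xi>: "\<forall>i\<in>eds_indices H n. \<xi> i \<in> eds_piece H n i"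
      define K where "K = \<xi> ` eds_indices H n"
      have "finite K" by (simp add: K_def eds_indices_def)
      moreover have KH: "K \<subseteq> H" using \<xi> eds_piece_subset by (force simp: K_def)
      ultimately have "K \<in> Fpow H" by (simp add: Fpow_def)
      have "real N * r \<le> real n * r" using n r(1) by (simp add: mult_right_mono)
      with N n have mesh: "(Sup H - Inf H) / real n < r"
        by (simp add: divide_less_eq mult.commute)
      \<comment> \<open>Each x lies in some piece, and the point chosen from that piece is within
        the mesh of x.\<close>
      have "H \<subseteq> nbhd K r"
      proof
        fix x assume "x \<in> H"
        then obtain i where i: "i \<in> eds_indices H n" "x \<in> eds_piece H n i"
          using eds_piece_cover[OF assms(1,2)] n by (metis gr_zeroI not_less0)
        with \<xi> dist_eds_piece mesh have "dist (\<xi> i) x < r" by (meson less_trans)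
        with i(1) \<open>x \<in> H\<close> show "x \<in> nbhd K r" by (auto simp: nbhd_def K_def)
      qed
      then have "hausdorff_dist K H < ereal \<delta>"
        using hausdorff_dist_space_le[OF KH r(1)] r(2) by (simp add: le_less_trans)
      from ext[OF \<open>K \<in> Fpow H\<close> this] show "\<bar>arith_mean (\<xi> ` eds_indices H n) - A\<bar> < \<epsilon>"
        by (simp add: K_def)
    qed
  qed
qed

end
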